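(* Let $d\ge1$ and let $H$ be a hypergraph of $d$-intervals. Then $\tau^*(H)\le\left(4d-6+\frac{3}{d}\right)\nu(H)$.
   Context: A $d$-interval is a union of at most $d$ pairwise disjoint closed intervals of the real line $\mathbb{R}$. A hypergraph of $d$-intervals is a finite family $H$ of $d$-intervals, regarded as a hypergraph whose vertices are the points of $\mathbb{R}$ and whose edges are the members of $H$. A matching is a set of pairwise disjoint edges and $\nu(H)$ is its maximum size. A fractional cover is a finitely supported $g:\mathbb{R}\to\mathbb{R}_{\ge0}$ with $\sum_{v\in h}g(v)\ge1$ for every $h\in H$; $\tau^*(H)$ is the infimum of $\sum_v g(v)$ over fractional covers. *)

theory Defs
  imports Complex_Main
begin

definition d_interval :: "nat \<Rightarrow> real set \<Rightarrow> bool" where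
  "d_interval d S \<longleftrightarrow>
     (\<exists>k (a :: nat \<Rightarrow> real) b. 1 \<le> k \<and> k \<le> d \<and> (\<forall>i<k. a i \<le> b i) \<and>
        (\<forall>i<k. \<forall>j<k. i \<noteq> j \<longrightarrow> {a i..b i} \<inter> {a j..b j} = {}) \<and>
        S = (\<Union>i<k. {a i..b i}))"

definition matching :: "real set set \<Rightarrow> real set set \<Rightarrow> bool" where
  "matching H M \<longleftrightarrow> M \<subseteq> H \<and> (\<forall>e\<in>M. \<forall>f\<in>M. e \<noteq> f \<longrightarrow> e \<inter> f = {})"

definition matching_number :: "real set set \<Rightarrow> nat" where
  "matching_number H = Max {card M | M. matching H M}"

definition supp :: "(real \<Rightarrow> real) \<Rightarrow> real set" where
  "supp g = {v. g v \<noteq> 0}"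

definition fractional_cover :: "real set set \<Rightarrow> (real \<Rightarrow> real) \<Rightarrow> bool" where
  "fractional_cover H g \<longleftrightarrow> finite (supp g) \<and> (\<forall>v. g v \<ge> 0) \<and>
     (\<forall>h\<in>H. (\<Sum>v\<in>supp g \<inter> h. g v) \<ge> 1)"

definition frac_cover_number :: "real set set \<Rightarrow> real" where
  "frac_cover_number H = Inf {(\<Sum>v\<in>supp g. g v) | g. fractional_cover H g}"

end

theory Submission
  imports Defs "HOL-Analysis.Brouwer_Fixpoint" "HOL-Homology.Simplices"
begin

text \<open>
  Everything rests on one topological fact: if \<open>u\<^sub>0, \<dots>, u\<^sub>p\<close> are nonnegative continuous functions on the
  standard simplex and \<open>u\<^sub>i\<close> vanishes on the facet \<open>x\<^sub>i = 0\<close>, then they take a common value at some point.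

  Applied to \<open>u\<^sub>i = x\<^sub>i * (\<Sum>\<^sub>k max 0 (F\<^sub>i - F\<^sub>k))\<close>, the common value must be \<open>0\<close>, because an index minimizing
  \<open>F\<close> has \<open>u\<^sub>i = 0\<close>; hence \<open>x\<close> is supported where \<open>F\<close> is minimal, and the minimax theorem follows. So
  \<open>\<tau>\<^sup>* \<le> K\<close> once, for all edge weights, some point carries at least the fraction \<open>1 / K\<close> of the weight.
  If every point has load at most \<open>L\<close>, then some edge meets edges of total weight at most
  \<open>2 d L\<close>, since of two \<open>d\<close>-intervals that meet one contains a right endpoint of the other (Alon); for
  \<open>d = 1\<close> the interval ending first even meets only weight \<open>L\<close>. Choosing such edges greedily gives
  \<open>\<tau>\<^sup>* \<le> 2 d \<nu>\<close>, and \<open>\<tau>\<^sup>* \<le> \<nu>\<close> for \<open>d = 1\<close>.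

  For \<open>d = 2\<close> (Tardos, Kaiser) let the simplex parametrize \<open>p = 3 \<nu>\<close> cuts of the line. An edge that
  avoids the cuts joins the two gaps containing its components, with a weight depending continuously on the
  cuts, and an empty gap receives no weight. So some cuts give all gaps the same total weight \<open>c\<close>. If
  \<open>c \<noteq> 0\<close>, a maximum matching in the graph of gaps has at least \<open>(p + 1) / 3 > \<nu>\<close> edges, which come from
  disjoint members of \<open>H\<close>. So \<open>c = 0\<close>, and the cuts pierce every edge.
\<close>

section \<open>The Poincare-Miranda theorem\<close>

text \<open>Unlike in the library's Brouwer theorem, the dimension is a term and not a type, since it will
  depend on the matching number.\<close>

lemma tendsto_fun_iff:
  fixes f :: "'a \<Rightarrow> 'i \<Rightarrow> 'b::topological_space"
  shows "(f \<longlongrightarrow> l) F \<longleftrightarrow> (\<forall>i. ((\<lambda>x. f x i) \<longlongrightarrow> l i) F)"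
  using limitin_componentwise[of "\<lambda>_. euclidean" UNIV f l F]
  by (simp add: euclidean_product_topology)

lemma tendsto_fun_uniformly_close:
  fixes f g :: "'a \<Rightarrow> 'i \<Rightarrow> 'b::real_normed_vector"
  assumes "(f \<longlongrightarrow> l) F" "(e \<longlongrightarrow> 0) F" "\<And>x i. norm (g x i - f x i) \<le> e x"
  shows "(g \<longlongrightarrow> l) F"
  unfolding tendsto_fun_iff
proof
  fix i
  have "((\<lambda>x. g x i - f x i) \<longlongrightarrow> 0) F"
    using assms(3) by (intro Lim_null_comparison[OF _ assms(2)] always_eventually) simp
  moreover have "((\<lambda>x. f x i) \<longlongrightarrow> l i) F"
    using assms(1) by (simp add: tendsto_fun_iff)
  ultimately have "((\<lambda>x. (g x i - f x i) + f x i) \<longlongrightarrow> 0 + l i) F"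
    by (rule tendsto_add)
  then show "((\<lambda>x. g x i) \<longlongrightarrow> l i) F"
    by simp
qed

definition unit_cube :: "('i \<Rightarrow> real) set" where
  "unit_cube = {x. \<forall>i. 0 \<le> x i \<and> x i \<le> 1}"

lemma compact_unit_cube: "compact (unit_cube :: ('i \<Rightarrow> real) set)"
proof -
  have "(unit_cube :: ('i \<Rightarrow> real) set) = PiE UNIV (\<lambda>_. {0..1})"
    by (auto simp: unit_cube_def PiE_iff)
  moreover have "compactin (product_topology (\<lambda>_. euclidean) UNIV) (PiE (UNIV :: 'i set) (\<lambda>_. {0..1::real}))"
    by (simp add: compactin_PiE)
  ultimately show ?thesis
    by (simp add: euclidean_product_topology)
qed

definition grid_point :: "nat \<Rightarrow> nat \<Rightarrow> (nat \<Rightarrow> nat) \<Rightarrow> nat \<Rightarrow> real" where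
  "grid_point n m q = (\<lambda>i. if i < n then real (q i) / real m else 0)"

lemma grid_point_in_unit_cube:
  assumes "\<And>i. i < n \<Longrightarrow> q i \<le> m"
  shows "grid_point n m q \<in> unit_cube"
  using assms by (auto simp: grid_point_def unit_cube_def divide_le_eq)

lemma grid_point_close:
  assumes "\<And>i. i < n \<Longrightarrow> q i \<le> r i \<and> r i \<le> q i + 1"
  shows "\<bar>grid_point n m r i - grid_point n m q i\<bar> \<le> 1 / real m"
proof -
  have "\<bar>real (r i) - real (q i)\<bar> / real m \<le> 1 / real m" if "i < n"
    using assms[OF that] by (intro divide_right_mono) auto
  then show ?thesis by (simp add: grid_point_def abs_divide flip: diff_divide_distrib)
qed

definition sign_changes_within ::
    "nat \<Rightarrow> ((nat \<Rightarrow> real) \<Rightarrow> nat \<Rightarrow> real) \<Rightarrow> real \<Rightarrow> (nat \<Rightarrow> real) \<Rightarrow> bool" where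
  "sign_changes_within n F e y \<longleftrightarrow> (\<forall>i<n.
    (\<exists>r\<in>unit_cube. (\<forall>j. \<bar>r j - y j\<bar> \<le> e) \<and> 0 \<le> F r i) \<and>
    (\<exists>s\<in>unit_cube. (\<forall>j. \<bar>s j - y j\<bar> \<le> e) \<and> F s i \<le> 0))"

lemma exists_sign_changes_within:
  fixes F :: "(nat \<Rightarrow> real) \<Rightarrow> nat \<Rightarrow> real" and m n :: nat
  assumes lower_face: "\<And>x i. x \<in> unit_cube \<Longrightarrow> i < n \<Longrightarrow> x i = 0 \<Longrightarrow> 0 \<le> F x i"
    and upper_face: "\<And>x i. x \<in> unit_cube \<Longrightarrow> i < n \<Longrightarrow> x i = 1 \<Longrightarrow> F x i \<le> 0"
    and "0 < m"
  shows "\<exists>y\<in>unit_cube. sign_changes_within n F (1 / real m) y"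
proof -
  define G where "G = grid_point n m"
  define label where "label q i = (if 0 \<le> F (G q) i \<and> q i \<noteq> m then 0 else 1 :: nat)" for q i
  have G_in: "G q \<in> unit_cube" if "\<forall>j<n. q j \<le> m" for q
    using that by (simp add: G_def grid_point_in_unit_cube)
  obtain q where q: "\<forall>i<n. q i < m" and differ:
    "\<forall>i<n. \<exists>r s. (\<forall>j<n. q j \<le> r j \<and> r j \<le> q j + 1) \<and> (\<forall>j<n. q j \<le> s j \<and> s j \<le> q j + 1) \<and> label r i \<noteq> label s i"
  proof (rule kuhn_lemma[OF \<open>0 < m\<close>, of n label])
    show "\<forall>x. (\<forall>i<n. x i \<le> m) \<longrightarrow> (\<forall>i<n. x i = 0 \<longrightarrow> label x i = 0)"
      using lower_face[OF G_in] \<open>0 < m\<close> by (auto simp: label_def G_def grid_point_def)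
  qed (auto simp: label_def)
  define cell where "cell = {r. \<forall>j<n. q j \<le> r j \<and> r j \<le> q j + 1}"
  have cell_in: "G r \<in> unit_cube" if "r \<in> cell" for r
    using that q unfolding cell_def by (intro G_in) fastforce
  have close: "\<bar>G r j - G q j\<bar> \<le> 1 / real m" if "r \<in> cell" for r j
    using that unfolding G_def cell_def by (intro grid_point_close) auto
  have "\<exists>r\<in>cell. \<exists>s\<in>cell. 0 \<le> F (G r) i \<and> F (G s) i \<le> 0" if i: "i < n" for i
  proof -
    obtain r s where "r \<in> cell" "s \<in> cell" "label r i \<noteq> label s i"
      using differ i unfolding cell_def by blast
    then obtain r s where r: "r \<in> cell" "label r i = 0" and s: "s \<in> cell" "label s i \<noteq> 0"
      by (cases "label r i = 0") (auto simp: label_def split: if_splits)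
    have "0 \<le> F (G r) i" using r(2) by (auto simp: label_def split: if_splits)
    moreover have "F (G s) i \<le> 0"
      using upper_face[OF cell_in[OF s(1)] i] s(2) i \<open>0 < m\<close>
      by (auto simp: label_def G_def grid_point_def split: if_splits)
    ultimately show ?thesis using r(1) s(1) by blast
  qed
  then have "sign_changes_within n F (1 / real m) (G q)"
    unfolding sign_changes_within_def using cell_in close by meson
  moreover have "G q \<in> unit_cube" using q by (intro G_in) (auto intro: less_imp_le)
  ultimately show ?thesis by blast
qed

lemma common_zero_of_sign_changes:
  fixes F :: "(nat \<Rightarrow> real) \<Rightarrow> nat \<Rightarrow> real"
  assumes cont: "\<And>i. i < n \<Longrightarrow> continuous_on unit_cube (\<lambda>x. F x i)"
    and close: "\<And>m. 0 < m \<Longrightarrow> \<exists>y\<in>unit_cube. sign_changes_within n F (1 / real m) y"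
  obtains z where "z \<in> unit_cube" "\<And>i. i < n \<Longrightarrow> F z i = 0"
proof -
  obtain y where y: "\<And>k. y k \<in> unit_cube"
    and pos: "\<And>k i. i < n \<Longrightarrow> \<exists>r\<in>unit_cube. (\<forall>j. \<bar>r j - y k j\<bar> \<le> 1 / real (Suc k)) \<and> 0 \<le> F r i"
    and neg: "\<And>k i. i < n \<Longrightarrow> \<exists>s\<in>unit_cube. (\<forall>j. \<bar>s j - y k j\<bar> \<le> 1 / real (Suc k)) \<and> F s i \<le> 0"
    using close[OF zero_less_Suc] unfolding sign_changes_within_def by metis
  have "seq_compact (unit_cube :: (nat \<Rightarrow> real) set)"
    using compact_unit_cube[where 'i = nat] by (simp only: compact_eq_seq_compact_metric)
  then obtain z \<phi> where z: "z \<in> unit_cube" and \<phi>: "strict_mono \<phi>" and lim_y: "(\<lambda>k. y (\<phi> k)) \<longlonglongrightarrow> z"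
    using y by (auto elim!: seq_compactE[of _ y] simp: o_def)
  have "(\<lambda>k. 1 / real (Suc (\<phi> k))) \<longlonglongrightarrow> 0"
    using LIMSEQ_subseq_LIMSEQ[OF LIMSEQ_inverse_real_of_nat \<phi>] by (simp add: o_def inverse_eq_divide)
  note lim_close = tendsto_fun_uniformly_close[OF lim_y this]
  have limit_in: "F z i \<in> C" if "i < n" "closed C"
    and ex: "\<And>k. \<exists>t\<in>unit_cube. (\<forall>j. \<bar>t j - y k j\<bar> \<le> 1 / real (Suc k)) \<and> F t i \<in> C" for i C
  proof -
    obtain t where t: "\<And>k. t k \<in> unit_cube \<and> (\<forall>j. \<bar>t k j - y k j\<bar> \<le> 1 / real (Suc k)) \<and> F (t k) i \<in> C"
      using ex by metis
    have "(\<lambda>k. t (\<phi> k)) \<longlonglongrightarrow> z" using t by (intro lim_close) simp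
    then have "(\<lambda>k. F (t (\<phi> k)) i) \<longlonglongrightarrow> F z i"
      using t by (intro continuous_on_tendsto_compose[OF cont[OF \<open>i < n\<close>] _ z]) auto
    then show ?thesis
      using t \<open>closed C\<close> by (intro Lim_in_closed_set[of C "\<lambda>k. F (t (\<phi> k)) i"]) auto
  qed
  have "F z i = 0" if i: "i < n" for i
    using limit_in[OF i, of "{0..}"] limit_in[OF i, of "{..0}"] pos[OF i] neg[OF i] by simp
  with z show thesis by (rule that)
qed

theorem poincare_miranda:
  fixes F :: "(nat \<Rightarrow> real) \<Rightarrow> nat \<Rightarrow> real"
  assumes "\<And>i. i < n \<Longrightarrow> continuous_on unit_cube (\<lambda>x. F x i)"
    and "\<And>x i. x \<in> unit_cube \<Longrightarrow> i < n \<Longrightarrow> x i = 0 \<Longrightarrow> 0 \<le> F x i"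
    and "\<And>x i. x \<in> unit_cube \<Longrightarrow> i < n \<Longrightarrow> x i = 1 \<Longrightarrow> F x i \<le> 0"
  obtains z where "z \<in> unit_cube" "\<And>i. i < n \<Longrightarrow> F z i = 0"
proof (rule common_zero_of_sign_changes[OF assms(1)])
  show "\<exists>y\<in>unit_cube. sign_changes_within n F (1 / real m) y" if "0 < m" for m
    using assms(2,3) that by (rule exists_sign_changes_within)
qed (assumption | rule that)+

section \<open>Equalization and minimax on the standard simplex\<close>

definition stick_breaking :: "nat \<Rightarrow> (nat \<Rightarrow> real) \<Rightarrow> nat \<Rightarrow> real" where
  "stick_breaking p z i = (if i \<le> p then (if i < p then z i else 1) * (\<Prod>k<i. 1 - z k) else 0)"

lemma stick_breaking_in_simplex:
  assumes "z \<in> unit_cube"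
  shows "stick_breaking p z \<in> standard_simplex p"
proof -
  have rest: "0 \<le> (\<Prod>k<i. 1 - z k) \<and> (\<Prod>k<i. 1 - z k) \<le> 1" for i
    using assms by (auto simp: unit_cube_def intro: prod_nonneg prod_le_1)
  have "(\<Sum>i<m. z i * (\<Prod>k<i. 1 - z k)) = 1 - (\<Prod>k<m. 1 - z k)" for m
    by (induction m) (auto simp: algebra_simps)
  then have "(\<Sum>i\<le>p. stick_breaking p z i) = 1"
    by (simp add: stick_breaking_def flip: lessThan_Suc_atMost)
  then show ?thesis
    using assms rest unfolding standard_simplex_def
    by (auto simp: stick_breaking_def unit_cube_def intro: mult_le_one)
qed

lemma continuous_on_stick_breaking: "continuous_on S (stick_breaking p)"
proof (rule continuous_on_coordinatewise_then_product)
  show "continuous_on S (\<lambda>z. stick_breaking p z i)" for i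
    unfolding stick_breaking_def
    by (cases "i < p"; cases "i = p")
      (auto intro!: continuous_intros continuous_on_subset[OF continuous_on_product_coordinates])
qed

lemma stick_breaking_eq_0_of_exhausted:
  assumes "z k = 1" "k < i"
  shows "stick_breaking p z i = 0"
proof -
  have "(\<Prod>l<i. 1 - z l) = 0" using assms by (intro prod_zero) auto
  then show ?thesis by (simp add: stick_breaking_def)
qed

lemma eq_last_of_eq_mean_of_later:
  fixes v :: "nat \<Rightarrow> real"
  assumes mean: "\<And>i. i < p \<Longrightarrow> real (p - i) * v i = (\<Sum>k\<in>{i<..p}. v k)" and "i \<le> p"
  shows "v i = v p"
  using \<open>i \<le> p\<close>
proof (induction "p - i" arbitrary: i rule: less_induct)
  case less
  show ?case
  proof (cases "i < p")
    case True
    have "(\<Sum>k\<in>{i<..p}. v k) = (\<Sum>k\<in>{i<..p}. v p)"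
      by (intro sum.cong less.hyps diff_less_mono2) auto
    then show ?thesis using mean[OF True] True by simp
  qed (use less.prems in simp)
qed

theorem equalize_on_standard_simplex:
  fixes u :: "(nat \<Rightarrow> real) \<Rightarrow> nat \<Rightarrow> real"
  assumes cont: "\<And>i. i \<le> p \<Longrightarrow> continuous_on (standard_simplex p) (\<lambda>x. u x i)"
    and nonneg: "\<And>x i. x \<in> standard_simplex p \<Longrightarrow> i \<le> p \<Longrightarrow> 0 \<le> u x i"
    and face: "\<And>x i. x \<in> standard_simplex p \<Longrightarrow> i \<le> p \<Longrightarrow> x i = 0 \<Longrightarrow> u x i = 0"
  obtains x c where "x \<in> standard_simplex p" "\<And>i. i \<le> p \<Longrightarrow> u x i = c"
proof -
  define v where "v z = u (stick_breaking p z)" for z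
  \<comment> \<open>If \<open>z i = 0\<close>, the piece \<open>i\<close> is empty; if \<open>z i = 1\<close>, all later pieces are.\<close>
  define F where "F z i = (\<Sum>k\<in>{i<..p}. v z k) - real (p - i) * v z i" for z i
  have v_nonneg: "0 \<le> v z i" if "z \<in> unit_cube" "i \<le> p" for z i
    using nonneg stick_breaking_in_simplex that by (simp add: v_def)
  have v_face: "v z i = 0" if "z \<in> unit_cube" "i \<le> p" "stick_breaking p z i = 0" for z i
    using face stick_breaking_in_simplex that by (simp add: v_def)
  obtain z where z: "z \<in> unit_cube" and zero: "\<And>i. i < p \<Longrightarrow> F z i = 0"
  proof (rule poincare_miranda[of p F])
    have "continuous_on unit_cube (\<lambda>z. v z i)" if "i \<le> p" for i
      unfolding v_def
      by (rule continuous_on_compose2[OF cont[OF that] continuous_on_stick_breaking])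
         (use stick_breaking_in_simplex in blast)
    then show "continuous_on unit_cube (\<lambda>z. F z i)" if "i < p" for i
      unfolding F_def using that by (intro continuous_intros) auto
    show "0 \<le> F z i" if "z \<in> unit_cube" "i < p" "z i = 0" for z i
      using that v_nonneg v_face[of z i] by (auto simp: F_def stick_breaking_def intro: sum_nonneg)
    show "F z i \<le> 0" if "z \<in> unit_cube" "i < p" "z i = 1" for z i
      using that v_nonneg[of z i] v_face[of z] stick_breaking_eq_0_of_exhausted[of z i]
      by (simp add: F_def)
  qed blast
  have "v z i = v z p" if "i \<le> p" for i
    using zero that by (intro eq_last_of_eq_mean_of_later) (auto simp: F_def)
  then show thesis
    unfolding v_def by (rule that[OF stick_breaking_in_simplex[OF z]])
qed

lemma variational_inequality_on_standard_simplex: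
  fixes F :: "(nat \<Rightarrow> real) \<Rightarrow> nat \<Rightarrow> real"
  assumes cont: "\<And>i. i \<le> p \<Longrightarrow> continuous_on (standard_simplex p) (\<lambda>x. F x i)"
  obtains x where "x \<in> standard_simplex p" "\<And>k. k \<le> p \<Longrightarrow> (\<Sum>i\<le>p. x i * F x i) \<le> F x k"
proof -
  define excess where "excess x i = (\<Sum>k\<le>p. max 0 (F x i - F x k))" for x i
  obtain x c where x: "x \<in> standard_simplex p" and c: "\<And>i. i \<le> p \<Longrightarrow> x i * excess x i = c"
  proof (rule equalize_on_standard_simplex[of p "\<lambda>x i. x i * excess x i"])
    show "continuous_on (standard_simplex p) (\<lambda>x. x i * excess x i)" if "i \<le> p" for i
      unfolding excess_def using that
      by (intro continuous_intros cont continuous_on_subset[OF continuous_on_product_coordinates]) auto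
    show "0 \<le> x i * excess x i" if "x \<in> standard_simplex p" for x i
      using that by (auto simp: excess_def standard_simplex_def intro!: mult_nonneg_nonneg sum_nonneg)
  qed auto
  obtain m where m: "m \<le> p" "\<And>k. k \<le> p \<Longrightarrow> F x m \<le> F x k"
    using ex_min_if_finite[of "F x ` {..p}"] by (auto simp: not_less)
  then have "excess x m = 0" by (simp add: excess_def)
  then have "c = 0" using c[OF m(1)] by simp
  have "x i * F x i \<le> x i * F x k" if "i \<le> p" "k \<le> p" for i k
  proof (cases "x i = 0")
    case False
    then have "excess x i = 0" using c[OF that(1)] \<open>c = 0\<close> by simp
    then have "max 0 (F x i - F x k) = 0"
      using that(2) by (simp add: excess_def sum_nonneg_eq_0_iff)
    then show ?thesis using x by (intro mult_left_mono) (auto simp: standard_simplex_def)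
  qed simp
  then have "(\<Sum>i\<le>p. x i * F x i) \<le> (\<Sum>i\<le>p. x i * F x k)" if "k \<le> p" for k
    using that by (intro sum_mono) auto
  then show thesis
    using x by (intro that) (auto simp: standard_simplex_def simp flip: sum_distrib_right)
qed

lemma minimax_standard_simplex:
  fixes A :: "nat \<Rightarrow> 'j \<Rightarrow> real"
  assumes "finite J"
    and heavy: "\<And>x. x \<in> standard_simplex p \<Longrightarrow> \<exists>j\<in>J. b < (\<Sum>i\<le>p. x i * A i j)"
  obtains g where "\<And>j. 0 \<le> g j" "sum g J = 1" "\<And>i. i \<le> p \<Longrightarrow> b \<le> (\<Sum>j\<in>J. A i j * g j)"
proof -
  define load where "load x j = (\<Sum>i\<le>p. x i * A i j)" for x j
  define g where "g x j = max 0 (load x j - b)" for x j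
  define F where "F x i = (\<Sum>j\<in>J. A i j * g x j)" for x i
  obtain x where x: "x \<in> standard_simplex p"
    and min: "\<And>k. k \<le> p \<Longrightarrow> (\<Sum>i\<le>p. x i * F x i) \<le> F x k"
  proof (rule variational_inequality_on_standard_simplex[of p F])
    show "continuous_on (standard_simplex p) (\<lambda>x. F x i)" for i
      unfolding F_def g_def load_def
      by (intro continuous_intros continuous_on_subset[OF continuous_on_product_coordinates]) auto
  qed blast
  have "\<exists>j\<in>J. 0 < g x j"
    using heavy[OF x] by (auto simp: g_def load_def less_max_iff_disj)
  then have total_pos: "0 < sum (g x) J"
    using \<open>finite J\<close> by (auto simp: g_def intro: sum_pos2)
  have bound: "b * sum (g x) J \<le> F x k" if "k \<le> p" for k
  proof -
    have "b * sum (g x) J \<le> (\<Sum>j\<in>J. load x j * g x j)"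
      unfolding sum_distrib_left
      by (intro sum_mono) (auto simp: g_def max_def intro: mult_right_mono)
    also have "\<dots> = (\<Sum>i\<le>p. x i * F x i)"
      unfolding load_def F_def sum_distrib_right sum_distrib_left
      by (subst sum.swap) (simp add: mult.assoc)
    also have "\<dots> \<le> F x k"
      using that by (rule min)
    finally show ?thesis .
  qed
  show thesis
  proof (rule that[of "\<lambda>j. g x j / sum (g x) J"])
    show "0 \<le> g x j / sum (g x) J" for j
      using total_pos by (simp add: g_def)
    show "(\<Sum>j\<in>J. g x j / sum (g x) J) = 1"
      using total_pos by (simp flip: sum_divide_distrib)
    show "b \<le> (\<Sum>j\<in>J. A i j * (g x j / sum (g x) J))" if "i \<le> p" for i
      using bound[OF that] total_pos by (simp add: F_def pos_le_divide_eq flip: sum_divide_distrib)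
  qed
qed

theorem minimax_finite:
  fixes A :: "'i \<Rightarrow> 'j \<Rightarrow> real"
  assumes "finite I" "I \<noteq> {}" "finite J"
    and heavy: "\<And>w. (\<And>i. i \<in> I \<Longrightarrow> 0 \<le> w i) \<Longrightarrow> sum w I = 1 \<Longrightarrow> \<exists>j\<in>J. b < (\<Sum>i\<in>I. w i * A i j)"
  obtains g where "\<And>j. 0 \<le> g j" "sum g J = 1" "\<And>i. i \<in> I \<Longrightarrow> b \<le> (\<Sum>j\<in>J. A i j * g j)"
proof -
  obtain p where "card I = Suc p"
    using assms(1,2) by (metis card_gt_0_iff gr0_implies_Suc)
  then obtain e where e: "bij_betw e {..p} I"
    using ex_bij_betw_nat_finite[OF \<open>finite I\<close>] by (metis atLeast0LessThan lessThan_Suc_atMost)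
  obtain g where g: "\<And>j. 0 \<le> g j" "sum g J = 1"
    and rows: "\<And>k. k \<le> p \<Longrightarrow> b \<le> (\<Sum>j\<in>J. A (e k) j * g j)"
  proof (rule minimax_standard_simplex[OF \<open>finite J\<close>, of p b "\<lambda>k. A (e k)"])
    fix x assume x: "x \<in> standard_simplex p"
    define w where "w i = x (inv_into {..p} e i)" for i
    have w_e: "w (e k) = x k" if "k \<le> p" for k
      using that e by (simp add: w_def bij_betw_inv_into_left)
    have "\<exists>j\<in>J. b < (\<Sum>i\<in>I. w i * A i j)"
      using x w_e by (intro heavy) (simp_all add: w_def standard_simplex_def flip: sum.reindex_bij_betw[OF e])
    then show "\<exists>j\<in>J. b < (\<Sum>k\<le>p. x k * A (e k) j)"
      using w_e by (simp flip: sum.reindex_bij_betw[OF e])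
  qed blast
  show thesis
  proof (rule that[OF g])
    fix i assume "i \<in> I"
    then obtain k where "i = e k" "k \<le> p" using e by (auto simp: bij_betw_def)
    then show "b \<le> (\<Sum>j\<in>J. A i j * g j)" using rows by simp
  qed
qed

section \<open>Fractional covers and light members\<close>

lemma card_le_matching_number:
  assumes "finite H" "matching H M"
  shows "card M \<le> matching_number H"
proof -
  have "{card M |M. matching H M} \<subseteq> card ` Pow H" by (auto simp: matching_def)
  then have "finite {card M |M. matching H M}" using assms(1) finite_surj by blast
  then show ?thesis unfolding matching_number_def using assms(2) by (intro Max_ge) auto
qed

lemma matching_iff_disjoint: "matching H M \<longleftrightarrow> M \<subseteq> H \<and> disjoint M"
  by (simp add: matching_def disjoint_def)

lemma frac_cover_number_le:
  assumes "fractional_cover H g"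
  shows "frac_cover_number H \<le> sum g (supp g)"
  unfolding frac_cover_number_def
proof (rule cInf_lower)
  show "bdd_below {sum g (supp g) |g. fractional_cover H g}"
    by (intro bdd_belowI[of _ 0]) (auto simp: fractional_cover_def intro: sum_nonneg)
qed (use assms in blast)

lemma frac_cover_number_le_sum:
  assumes "finite Q" "\<And>v. v \<in> Q \<Longrightarrow> 0 \<le> g v" "\<And>h. h \<in> H \<Longrightarrow> 1 \<le> sum g (Q \<inter> h)"
  shows "frac_cover_number H \<le> sum g Q"
proof -
  define f where "f v = (if v \<in> Q then g v else 0)" for v
  have supp: "supp f \<subseteq> Q" by (auto simp: supp_def f_def)
  have sum_f: "sum f (supp f \<inter> S) = sum g (Q \<inter> S)" for S
    using \<open>finite Q\<close> supp by (intro sum.mono_neutral_cong_left) (auto simp: supp_def f_def)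
  have "fractional_cover H f"
    unfolding fractional_cover_def
    using assms finite_subset[OF supp] by (auto simp: sum_f) (simp add: f_def)
  from frac_cover_number_le[OF this] show ?thesis using sum_f[of UNIV] by simp
qed

lemma frac_cover_number_le_card:
  assumes "finite C" "\<And>h. h \<in> H \<Longrightarrow> C \<inter> h \<noteq> {}"
  shows "frac_cover_number H \<le> real (card C)"
proof -
  have "1 \<le> (\<Sum>v\<in>C \<inter> h. 1 :: real)" if "h \<in> H" for h
    using assms that by (simp add: Suc_le_eq card_gt_0_iff)
  from frac_cover_number_le_sum[OF assms(1) _ this] show ?thesis by simp
qed

definition load :: "'a set set \<Rightarrow> ('a set \<Rightarrow> real) \<Rightarrow> 'a \<Rightarrow> real" where
  "load H w v = sum w {h \<in> H. v \<in> h}"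

definition meeting_weight :: "'a set set \<Rightarrow> ('a set \<Rightarrow> real) \<Rightarrow> 'a set \<Rightarrow> real" where
  "meeting_weight H w S = sum w {h \<in> H. \<not> disjnt S h}"

lemma frac_cover_number_le_inverse:
  assumes "finite H" "finite Q" "0 < b"
    and heavy: "\<And>w. (\<And>h. h \<in> H \<Longrightarrow> 0 \<le> w h) \<Longrightarrow> sum w H = 1 \<Longrightarrow> \<exists>v\<in>Q. b < load H w v"
  shows "frac_cover_number H \<le> 1 / b"
proof (cases "H = {}")
  case True
  then have "frac_cover_number H \<le> 0" using frac_cover_number_le_card[of "{}" H] by simp
  also have "0 \<le> 1 / b" using \<open>0 < b\<close> by simp
  finally show ?thesis .
next
  case False
  obtain g where g: "\<And>v. 0 \<le> g v" "sum g Q = 1"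
    and cover: "\<And>h. h \<in> H \<Longrightarrow> b \<le> (\<Sum>v\<in>Q. of_bool (v \<in> h) * g v)"
    by (rule minimax_finite[OF assms(1) False assms(2), of b "\<lambda>h v. of_bool (v \<in> h)"])
       (use heavy assms(1) in \<open>auto simp: load_def Int_def\<close>)
  have "frac_cover_number H \<le> (\<Sum>v\<in>Q. g v / b)"
  proof (rule frac_cover_number_le_sum[OF assms(2)])
    show "0 \<le> g v / b" for v using g(1) \<open>0 < b\<close> by simp
    show "1 \<le> (\<Sum>v\<in>Q \<inter> h. g v / b)" if "h \<in> H" for h
      using cover[OF that] assms(2) \<open>0 < b\<close> by (simp flip: sum_divide_distrib)
  qed
  then show ?thesis using g(2) by (simp flip: sum_divide_distrib)
qed

lemma frac_cover_number_le_of_heavy_points: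
  assumes "finite H" "finite Q" "0 \<le> K"
    and heavy: "\<And>w. (\<And>h. h \<in> H \<Longrightarrow> 0 \<le> w h) \<Longrightarrow> \<exists>v\<in>Q. sum w H \<le> K * load H w v"
  shows "frac_cover_number H \<le> K"
proof (rule dense_ge)
  fix K' assume "K < K'"
  then have "0 < K'" using \<open>0 \<le> K\<close> by simp
  have "frac_cover_number H \<le> 1 / (1 / K')"
  proof (rule frac_cover_number_le_inverse[OF assms(1,2)])
    fix w :: "real set \<Rightarrow> real" assume w: "\<And>h. h \<in> H \<Longrightarrow> 0 \<le> w h" "sum w H = 1"
    then obtain v where v: "v \<in> Q" "1 \<le> K * load H w v" using heavy by metis
    have "0 \<le> load H w v" using w by (auto simp: load_def intro: sum_nonneg)
    moreover have "load H w v \<noteq> 0" using v(2) by auto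
    ultimately have "0 < load H w v" by simp
    then have "1 < K' * load H w v"
      using v(2) \<open>K < K'\<close> by (meson le_less_trans mult_strict_right_mono)
    then show "\<exists>v\<in>Q. 1 / K' < load H w v"
      using v(1) \<open>0 < K'\<close> by (auto simp: pos_divide_less_eq mult.commute)
  qed (use \<open>0 < K'\<close> in simp)
  then show "frac_cover_number H \<le> K'" by simp
qed

lemma disjoint_subfamily_of_light_members:
  fixes H :: "'a set set" and w :: "'a set \<Rightarrow> real"
  assumes "finite H" "{} \<notin> H"
    and light: "\<And>G. G \<subseteq> H \<Longrightarrow> G \<noteq> {} \<Longrightarrow> \<exists>h\<in>G. meeting_weight G w h \<le> B"
  shows "\<exists>M\<subseteq>H. disjoint M \<and> sum w H \<le> B * real (card M)"
  using assms
proof (induction H rule: finite_psubset_induct)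
  case (psubset H)
  show ?case
  proof (cases "H = {}")
    case False
    then obtain h where h: "h \<in> H" and light_h: "meeting_weight H w h \<le> B"
      using psubset.prems(2)[of H] by blast
    define R where "R = {g \<in> H. disjnt h g}"
    have "h \<notin> R" using h psubset.prems(1) by (auto simp: R_def disjnt_def)
    then have "R \<subset> H" using h unfolding R_def by blast
    have "\<exists>M\<subseteq>R. disjoint M \<and> sum w R \<le> B * real (card M)"
    proof (rule psubset.IH[OF \<open>R \<subset> H\<close>])
      show "{} \<notin> R" using psubset.prems(1) \<open>R \<subset> H\<close> by blast
      show "\<exists>h\<in>G. meeting_weight G w h \<le> B" if "G \<subseteq> R" "G \<noteq> {}" for G
        using psubset.prems(2)[of G] that \<open>R \<subset> H\<close> by blast
    qed
    then obtain M where M: "M \<subseteq> R" "disjoint M" and le: "sum w R \<le> B * real (card M)" by blast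
    have "sum w H = sum w R + meeting_weight H w h"
      unfolding meeting_weight_def R_def using psubset.hyps
      by (subst sum.union_disjoint[symmetric]) (auto intro: arg_cong[of _ _ "sum w"])
    also have "\<dots> \<le> B * real (card (insert h M))"
    proof -
      have "h \<notin> M" "finite M"
        using M(1) \<open>h \<notin> R\<close> \<open>R \<subset> H\<close> finite_subset[OF _ psubset.hyps(1)] by blast+
      then show ?thesis using le light_h by (simp add: algebra_simps)
    qed
    finally have "sum w H \<le> B * real (card (insert h M))" .
    moreover have "disjoint (insert h M)"
      using M by (auto simp: pairwise_insert R_def disjnt_sym)
    ultimately show ?thesis
      using M(1) h \<open>R \<subset> H\<close> by (intro exI[of _ "insert h M"]) auto
  qed (intro exI[of _ "{}"], simp)
qed

lemma frac_cover_number_le_of_light_members: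
  assumes "finite H" "{} \<notin> H" "finite Q" "0 \<le> k"
    and light: "\<And>G w L. G \<subseteq> H \<Longrightarrow> G \<noteq> {} \<Longrightarrow> (\<And>h. h \<in> H \<Longrightarrow> 0 \<le> w h) \<Longrightarrow> 0 \<le> L \<Longrightarrow>
      (\<And>v. v \<in> Q \<Longrightarrow> load G w v \<le> L) \<Longrightarrow> \<exists>h\<in>G. meeting_weight G w h \<le> k * L"
  shows "frac_cover_number H \<le> k * real (matching_number H)"
proof (rule frac_cover_number_le_of_heavy_points[OF assms(1)])
  \<comment> \<open>The point \<open>0\<close> only serves to make the set nonempty.\<close>
  show "finite (insert 0 Q)" using assms(3) by simp
  show "0 \<le> k * real (matching_number H)" using assms(4) by simp
  fix w :: "real set \<Rightarrow> real" assume w: "\<And>h. h \<in> H \<Longrightarrow> 0 \<le> w h"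
  define L where "L = Max (load H w ` insert 0 Q)"
  have "L \<in> load H w ` insert 0 Q"
    unfolding L_def using assms(3) by (intro Max_in) auto
  then obtain v where v: "v \<in> insert 0 Q" "L = load H w v" by blast
  have "0 \<le> L" unfolding v(2) load_def using w by (intro sum_nonneg) auto
  have "\<exists>M\<subseteq>H. disjoint M \<and> sum w H \<le> k * L * real (card M)"
  proof (rule disjoint_subfamily_of_light_members[OF assms(1,2)])
    fix G assume G: "G \<subseteq> H" "G \<noteq> {}"
    show "\<exists>h\<in>G. meeting_weight G w h \<le> k * L"
    proof (rule light[OF G w \<open>0 \<le> L\<close>])
      fix q assume "q \<in> Q"
      have "load G w q \<le> load H w q"
        unfolding load_def using assms(1) G w by (intro sum_mono2) auto
      also have "\<dots> \<le> L"
        unfolding L_def using \<open>q \<in> Q\<close> assms(3) by (intro Max_ge) auto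
      finally show "load G w q \<le> L" .
    qed
  qed
  then obtain M where M: "matching H M" and "sum w H \<le> k * L * real (card M)"
    by (auto simp: matching_iff_disjoint)
  note this(2)
  also have "\<dots> \<le> k * L * real (matching_number H)"
    using card_le_matching_number[OF assms(1) M] assms(4) \<open>0 \<le> L\<close> by (intro mult_left_mono) auto
  finally show "\<exists>v\<in>insert 0 Q. sum w H \<le> k * real (matching_number H) * load H w v"
    using v by (auto simp: mult_ac)
qed

lemma exists_le_weighted_average:
  fixes w f :: "'a \<Rightarrow> real"
  assumes "finite S" "\<And>x. x \<in> S \<Longrightarrow> 0 \<le> w x" "0 < sum w S" "(\<Sum>x\<in>S. w x * f x) \<le> B * sum w S"
  shows "\<exists>x\<in>S. f x \<le> B"
proof (rule ccontr)
  assume "\<not> ?thesis"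
  then have gt: "B < f x" if "x \<in> S" for x using that by force
  then have terms_nonneg: "0 \<le> w x * (f x - B)" if "x \<in> S" for x
    using assms(2)[OF that] that by (simp add: less_imp_le)
  have "(\<Sum>x\<in>S. w x * (f x - B)) = (\<Sum>x\<in>S. w x * f x) - B * sum w S"
    by (simp add: right_diff_distrib sum_subtractf sum_distrib_left mult.commute)
  then have "(\<Sum>x\<in>S. w x * (f x - B)) = 0"
    using assms(4) terms_nonneg by (intro antisym sum_nonneg) auto
  then have "w x = 0" if "x \<in> S" for x
    using sum_nonneg_0[OF assms(1) terms_nonneg] gt[OF that] that by fastforce
  then have "sum w S = 0" by simp
  with assms(3) show False by simp
qed

lemma meeting_weight_le_card_mult:
  fixes w :: "'a set \<Rightarrow> real"
  assumes "finite G" "\<And>g. g \<in> G \<Longrightarrow> 0 \<le> w g" "finite P"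
    and load: "\<And>v. v \<in> P \<Longrightarrow> load G w v \<le> L"
  shows "meeting_weight G w P \<le> real (card P) * L"
proof -
  have "meeting_weight G w P = sum w {g \<in> G. \<not> disjnt P g}"
    by (simp add: meeting_weight_def)
  also have "\<dots> \<le> (\<Sum>g\<in>{g \<in> G. \<not> disjnt P g}. real (card (P \<inter> g)) * w g)"
  proof (rule sum_mono)
    fix g assume g: "g \<in> {g \<in> G. \<not> disjnt P g}"
    then have "1 \<le> card (P \<inter> g)"
      using assms(3) by (simp add: disjnt_def Suc_le_eq card_gt_0_iff)
    then show "w g \<le> real (card (P \<inter> g)) * w g"
      using mult_right_mono[of 1 "real (card (P \<inter> g))" "w g"] assms(2) g by simp
  qed
  also have "\<dots> \<le> (\<Sum>g\<in>G. real (card (P \<inter> g)) * w g)"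
    using assms(1,2) by (intro sum_mono2) auto
  also have "\<dots> = (\<Sum>g\<in>G. \<Sum>v\<in>{v \<in> P. v \<in> g}. w g)"
    by (simp add: Int_def)
  also have "\<dots> = (\<Sum>v\<in>P. load G w v)"
    unfolding load_def using assms(1,3) by (rule sum.swap_restrict)
  also have "\<dots> \<le> real (card P) * L"
    using load by (rule sum_bounded_above)
  finally show ?thesis .
qed

lemma sum_meeting_weight_le:
  fixes w :: "'a set \<Rightarrow> real"
  assumes "finite G" and w: "\<And>g. g \<in> G \<Longrightarrow> 0 \<le> w g"
    and meet: "\<And>g h. g \<in> G \<Longrightarrow> h \<in> G \<Longrightarrow> \<not> disjnt g h \<Longrightarrow> \<not> disjnt (P g) h \<or> \<not> disjnt (P h) g"
  shows "(\<Sum>h\<in>G. w h * meeting_weight G w h) \<le> 2 * (\<Sum>h\<in>G. w h * meeting_weight G w (P h))"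
proof -
  have "(\<Sum>h\<in>G. w h * meeting_weight G w h) \<le>
      (\<Sum>h\<in>G. w h * (sum w {g \<in> G. \<not> disjnt (P g) h} + meeting_weight G w (P h)))"
  proof (intro sum_mono mult_left_mono w)
    fix h assume h: "h \<in> G"
    have "meeting_weight G w h \<le> sum w ({g \<in> G. \<not> disjnt (P g) h} \<union> {g \<in> G. \<not> disjnt (P h) g})"
      unfolding meeting_weight_def using assms(1) w meet h by (intro sum_mono2) auto
    also have "\<dots> \<le> sum w {g \<in> G. \<not> disjnt (P g) h} + meeting_weight G w (P h)"
      unfolding meeting_weight_def using assms(1) w by (auto simp: sum_Un intro: sum_nonneg)
    finally show "meeting_weight G w h \<le>
        sum w {g \<in> G. \<not> disjnt (P g) h} + meeting_weight G w (P h)" .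
  qed
  also have "\<dots> = (\<Sum>h\<in>G. w h * sum w {g \<in> G. \<not> disjnt (P g) h}) + (\<Sum>h\<in>G. w h * meeting_weight G w (P h))"
    by (simp add: distrib_left sum.distrib)
  also have "(\<Sum>h\<in>G. w h * sum w {g \<in> G. \<not> disjnt (P g) h}) = (\<Sum>h\<in>G. w h * meeting_weight G w (P h))"
    unfolding meeting_weight_def sum_distrib_left using assms(1) by (subst sum.swap_restrict) (auto simp: mult.commute)
  finally show ?thesis by simp
qed

lemma exists_light_member:
  fixes w :: "'a set \<Rightarrow> real"
  assumes "finite G" "G \<noteq> {}" and w: "\<And>g. g \<in> G \<Longrightarrow> 0 \<le> w g"
    and P: "\<And>g. g \<in> G \<Longrightarrow> finite (P g) \<and> card (P g) \<le> d"
    and meet: "\<And>g h. g \<in> G \<Longrightarrow> h \<in> G \<Longrightarrow> \<not> disjnt g h \<Longrightarrow> \<not> disjnt (P g) h \<or> \<not> disjnt (P h) g"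
    and "0 \<le> L" and load: "\<And>g v. g \<in> G \<Longrightarrow> v \<in> P g \<Longrightarrow> load G w v \<le> L"
  shows "\<exists>h\<in>G. meeting_weight G w h \<le> 2 * real d * L"
proof (cases "sum w G = 0")
  case True
  have "meeting_weight G w h \<le> sum w G" for h
    unfolding meeting_weight_def using assms(1) w by (intro sum_mono2) auto
  also have "\<dots> \<le> 2 * real d * L" using True \<open>0 \<le> L\<close> by simp
  finally show ?thesis using assms(2) by blast
next
  case False
  then have "0 < sum w G" using w by (simp add: sum_nonneg order_less_le)
  have hit: "meeting_weight G w (P h) \<le> real d * L" if "h \<in> G" for h
  proof -
    have "meeting_weight G w (P h) \<le> real (card (P h)) * L"
      using P that load by (intro meeting_weight_le_card_mult assms(1) w) auto
    also have "\<dots> \<le> real d * L"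
      using P that \<open>0 \<le> L\<close> by (intro mult_right_mono) auto
    finally show ?thesis .
  qed
  have "(\<Sum>h\<in>G. w h * meeting_weight G w h) \<le> 2 * (\<Sum>h\<in>G. w h * meeting_weight G w (P h))"
    using assms(1) w meet by (rule sum_meeting_weight_le)
  also have "\<dots> \<le> 2 * (\<Sum>h\<in>G. w h * (real d * L))"
    using w hit by (intro mult_left_mono sum_mono) auto
  also have "\<dots> = 2 * real d * L * sum w G"
    by (simp add: mult_ac flip: sum_distrib_left)
  finally show ?thesis
    using assms(1) w \<open>0 < sum w G\<close> by (intro exists_le_weighted_average[of G w])
qed

section \<open>Right endpoints of intervals\<close>

definition has_right_ends :: "real set \<Rightarrow> real set \<Rightarrow> bool" where
  "has_right_ends h P \<longleftrightarrow> finite P \<and> (\<forall>x\<in>h. \<exists>v\<in>P. x \<le> v \<and> {x..v} \<subseteq> h)"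

lemma d_interval_nonempty:
  assumes "d_interval d h"
  shows "h \<noteq> {}"
  using assms unfolding d_interval_def by fastforce

lemma d_interval_has_right_ends:
  assumes "d_interval d h"
  shows "\<exists>P. has_right_ends h P \<and> card P \<le> d"
proof -
  obtain k :: nat and a b :: "nat \<Rightarrow> real" where "k \<le> d" and h: "h = (\<Union>i<k. {a i..b i})"
    using assms unfolding d_interval_def by blast
  have "\<exists>v\<in>b ` {..<k}. x \<le> v \<and> {x..v} \<subseteq> h" if "x \<in> h" for x
    using that unfolding h by fastforce
  moreover have "card (b ` {..<k}) \<le> d"
    using card_image_le[of "{..<k}" b] \<open>k \<le> d\<close> by simp
  ultimately show ?thesis
    by (intro exI[of _ "b ` {..<k}"]) (simp add: has_right_ends_def)
qed

lemma has_right_ends_meet: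
  assumes "has_right_ends g P" "has_right_ends h R" "\<not> disjnt g h"
  shows "\<not> disjnt P h \<or> \<not> disjnt R g"
proof -
  obtain x where x: "x \<in> g" "x \<in> h" using assms(3) by (auto simp: disjnt_def)
  obtain u where u: "u \<in> P" "x \<le> u" "{x..u} \<subseteq> g" using assms(1) x(1) unfolding has_right_ends_def by blast
  obtain v where v: "v \<in> R" "x \<le> v" "{x..v} \<subseteq> h" using assms(2) x(2) unfolding has_right_ends_def by blast
  have "u \<in> {x..v} \<or> v \<in> {x..u}" using u(2) v(2) by auto
  then have "u \<in> h \<or> v \<in> g" using u(3) v(3) by blast
  then show ?thesis using u(1) v(1) by (auto simp: disjnt_def)
qed

theorem frac_cover_number_d_intervals_le:
  assumes "finite H" "\<forall>h\<in>H. d_interval d h"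
  shows "frac_cover_number H \<le> 2 * real d * real (matching_number H)"
proof -
  obtain P where P: "\<forall>h\<in>H. has_right_ends h (P h) \<and> card (P h) \<le> d"
    using assms(2) d_interval_has_right_ends by metis
  show ?thesis
  proof (rule frac_cover_number_le_of_light_members[OF assms(1)])
    show "{} \<notin> H" using assms(2) d_interval_nonempty by blast
    show "finite (\<Union>h\<in>H. P h)" using assms(1) P by (auto simp: has_right_ends_def)
    fix G and w :: "real set \<Rightarrow> real" and L :: real
    assume G: "G \<subseteq> H" "G \<noteq> {}" and w: "\<And>h. h \<in> H \<Longrightarrow> 0 \<le> w h" and "0 \<le> L"
      and load: "\<And>v. v \<in> (\<Union>h\<in>H. P h) \<Longrightarrow> load G w v \<le> L"
    show "\<exists>h\<in>G. meeting_weight G w h \<le> 2 * real d * L"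
    proof (rule exists_light_member[OF finite_subset[OF G(1) assms(1)] G(2)])
      show "finite (P g) \<and> card (P g) \<le> d" if "g \<in> G" for g
        using P G(1) that by (auto simp: has_right_ends_def)
      show "\<not> disjnt (P g) h \<or> \<not> disjnt (P h) g" if "g \<in> G" "h \<in> G" "\<not> disjnt g h" for g h
        using P G(1) that by (intro has_right_ends_meet[OF _ _ that(3)]) auto
    qed (use G(1) w \<open>0 \<le> L\<close> load in blast)+
  qed simp
qed

lemma d_interval_1D:
  assumes "d_interval 1 h"
  shows "\<exists>a b. a \<le> b \<and> h = {a..b}"
proof -
  obtain k :: nat and a b :: "nat \<Rightarrow> real"
    where "1 \<le> k" "k \<le> 1" and ab: "\<forall>i<k. a i \<le> b i" "h = (\<Union>i<k. {a i..b i})"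
    using assms unfolding d_interval_def by blast
  then have "k = 1" by simp
  with ab show ?thesis by auto
qed

theorem frac_cover_number_intervals_le:
  assumes "finite H" "\<forall>h\<in>H. d_interval 1 h"
  shows "frac_cover_number H \<le> real (matching_number H)"
proof -
  have "frac_cover_number H \<le> 1 * real (matching_number H)"
  proof (rule frac_cover_number_le_of_light_members[OF assms(1)])
    show "{} \<notin> H" using assms(2) d_interval_nonempty by blast
    show "finite (Sup ` H)" using assms(1) by simp
    fix G and w :: "real set \<Rightarrow> real" and L :: real
    assume G: "G \<subseteq> H" "G \<noteq> {}" and w: "\<And>h. h \<in> H \<Longrightarrow> 0 \<le> w h"
      and load: "\<And>v. v \<in> Sup ` H \<Longrightarrow> load G w v \<le> L"
    have "finite G" using G(1) assms(1) by (rule finite_subset)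
    then obtain h where h: "h \<in> G" and leftmost: "\<And>g. g \<in> G \<Longrightarrow> Sup h \<le> Sup g"
      using ex_min_if_finite[of "Sup ` G"] G(2) by (auto simp: not_less)
    have "Sup h \<in> g" if g: "g \<in> G" "\<not> disjnt h g" for g
    proof -
      obtain a b a' b' where "g = {a..b}" "h = {a'..b'}" "a \<le> b" "a' \<le> b'"
        using assms(2) G(1) g(1) h by (metis d_interval_1D subsetD)
      then show ?thesis using g(2) leftmost[OF g(1)] by (auto simp: disjnt_def)
    qed
    then have "meeting_weight G w h \<le> load G w (Sup h)"
      unfolding load_def meeting_weight_def using \<open>finite G\<close> w G(1) by (intro sum_mono2) auto
    also have "\<dots> \<le> 1 * L" using load h G(1) by auto
    finally show "\<exists>h\<in>G. meeting_weight G w h \<le> 1 * L" using h by blast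
  qed simp
  then show ?thesis by simp
qed

section \<open>Matchings in regularly weighted graphs\<close>

definition maximum_packing :: "'a set set \<Rightarrow> 'a set set \<Rightarrow> bool" where
  "maximum_packing X E \<longleftrightarrow> E \<subseteq> X \<and> disjoint E \<and> (\<forall>F\<subseteq>X. disjoint F \<longrightarrow> card F \<le> card E)"

lemma exists_maximum_packing:
  assumes "finite X"
  obtains E where "maximum_packing X E"
proof -
  have "\<exists>E. (E \<subseteq> X \<and> disjoint E) \<and> (\<forall>F. F \<subseteq> X \<and> disjoint F \<longrightarrow> card F \<le> card E)"
    by (rule ex_has_greatest_nat[of _ "{}" card "Suc (card X)"])
       (auto simp: less_Suc_eq_le intro: card_mono[OF assms])
  then show thesis using that unfolding maximum_packing_def by blast
qed

lemma maximum_packing_meets: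
  assumes "maximum_packing X E" "finite E" "f \<in> X" "f \<noteq> {}"
  shows "\<not> disjnt f (\<Union>E)"
proof
  assume free: "disjnt f (\<Union>E)"
  then have "f \<notin> E" using assms(4) by (auto simp: disjnt_def)
  have "disjoint (insert f E)"
    using assms(1) free by (auto simp: maximum_packing_def pairwise_insert disjnt_sym)
  moreover have "insert f E \<subseteq> X" using assms(1,3) by (auto simp: maximum_packing_def)
  ultimately have "card (insert f E) \<le> card E"
    using assms(1) unfolding maximum_packing_def by blast
  then show False using \<open>f \<notin> E\<close> assms(2) by simp
qed

lemma maximum_packing_no_exchange:
  assumes "maximum_packing X E" "finite E" "e \<in> E"
    and f: "f \<in> X" "f \<noteq> {}" "f \<inter> \<Union>E \<subseteq> e" and g: "g \<in> X" "g \<noteq> {}" "g \<inter> \<Union>E \<subseteq> e"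
  shows "\<not> disjnt f g"
proof
  assume "disjnt f g"
  define R where "R = E - {e}"
  have R: "R \<subseteq> X" "disjoint R" "finite R"
    using assms(1,2) by (auto simp: maximum_packing_def R_def intro: pairwise_subset)
  have free: "disjnt k r" if "k \<inter> \<Union>E \<subseteq> e" "r \<in> R" for k r
  proof -
    have "disjnt e r" using assms(1,3) that(2) by (auto simp: maximum_packing_def R_def pairwise_def)
    then show ?thesis using that by (auto simp: disjnt_def R_def)
  qed
  have "disjoint (insert f (insert g R))"
    using R(2) \<open>disjnt f g\<close> free[OF f(3)] free[OF g(3)] by (auto simp: pairwise_insert disjnt_sym)
  moreover have "insert f (insert g R) \<subseteq> X" using R(1) f(1) g(1) by blast
  ultimately have "card (insert f (insert g R)) \<le> card E"
    using assms(1) unfolding maximum_packing_def by blast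
  moreover have "f \<notin> insert g R" "g \<notin> R"
    using free[OF f(3), of f] free[OF g(3), of g] \<open>disjnt f g\<close> f(2) g(2) by auto
  ultimately show False
    using R(3) card.remove[OF assms(2,3)] by (simp add: R_def)
qed

locale regular_weighting =
  fixes V :: "'a set" and A :: "'a \<Rightarrow> 'a \<Rightarrow> real" and c :: real
  assumes finite_V: "finite V" and sym: "A u v = A v u" and nonneg: "0 \<le> A u v"
    and row_sum: "u \<in> V \<Longrightarrow> (\<Sum>v\<in>V. A u v) = c" and c_pos: "0 < c"
begin

definition edges :: "'a set set" where
  "edges = {{u, v} |u v. u \<in> V \<and> v \<in> V \<and> 0 < A u v}"

lemma edges_subset_Pow: "edges \<subseteq> Pow V"
  by (auto simp: edges_def)

lemma partial_row_sum_le: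
  assumes "S \<subseteq> V" "u \<in> V"
  shows "(\<Sum>v\<in>S. A u v) \<le> c"
  using sum_mono2[OF finite_V assms(1), of "A u"] nonneg row_sum[OF assms(2)] by simp

lemma same_unmatched_neighbour:
  assumes E: "maximum_packing edges E" "finite E" "{a, b} \<in> E" "a \<noteq> b"
    and u: "u \<in> V - \<Union>E" "A u a \<noteq> 0" and v: "v \<in> V - \<Union>E" "A v b \<noteq> 0"
  shows "u = v"
proof (rule ccontr)
  assume "u \<noteq> v"
  have ab: "a \<in> \<Union>E" "b \<in> \<Union>E" "a \<in> V" "b \<in> V"
    using E(1,3) edges_subset_Pow by (auto simp: maximum_packing_def)
  have pos: "0 < A u a" "0 < A v b"
    using u(2) v(2) nonneg by (simp_all add: order_less_le)
  have "\<not> disjnt {u, a} {v, b}"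
  proof (rule maximum_packing_no_exchange[OF E(1-3)])
    show "{u, a} \<in> edges" "{v, b} \<in> edges"
      using pos u(1) v(1) ab unfolding edges_def by blast+
  qed (use u(1) v(1) in auto)
  then show False using \<open>u \<noteq> v\<close> E(4) u(1) v(1) ab by auto
qed

lemma unmatched_weight_le:
  assumes E: "maximum_packing edges E" "finite E" "e \<in> E"
  shows "(\<Sum>a\<in>e. \<Sum>u\<in>V - \<Union>E. A u a) \<le> c"
proof -
  define U where "U = V - \<Union>E"
  have column_le: "(\<Sum>u\<in>U. A u a) \<le> c" if "a \<in> V" for a
    using partial_row_sum_le[of U a] that sym by (simp add: U_def)
  obtain a b where ab: "e = {a, b}" "a \<in> V" "b \<in> V"
    using E(1,3) by (auto simp: maximum_packing_def edges_def)
  consider "a = b" | "a \<noteq> b" "\<forall>u\<in>U. A u a = 0" | "a \<noteq> b" "\<forall>u\<in>U. A u b = 0"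
    | u v where "a \<noteq> b" "u \<in> U" "A u a \<noteq> 0" "v \<in> U" "A v b \<noteq> 0" by blast
  then have "(\<Sum>a\<in>e. \<Sum>u\<in>U. A u a) \<le> c"
  proof cases
    case (4 u v)
    have same: "w = w'" if "w \<in> U" "w' \<in> U" "A w a \<noteq> 0" "A w' b \<noteq> 0" for w w'
      using same_unmatched_neighbour[OF E(1,2) _ \<open>a \<noteq> b\<close>] E(3) ab(1) that by (simp add: U_def)
    have "A w a = 0 \<and> A w b = 0" if "w \<in> U - {u}" for w
      using same[of w v] same[of u w] same[of u v] 4 that by auto
    then have "(\<Sum>w\<in>U. A w x) = A u x" if "x \<in> {a, b}" for x
      using 4(2) finite_V that by (subst sum.remove[of U u]) (auto simp: U_def)
    then have "(\<Sum>x\<in>e. \<Sum>w\<in>U. A w x) = (\<Sum>x\<in>e. A u x)"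
      unfolding ab(1) by (intro sum.cong) auto
    also have "\<dots> \<le> c"
      using 4(2) ab by (intro partial_row_sum_le) (auto simp: U_def)
    finally show ?thesis .
  qed (use ab column_le in auto)
  then show ?thesis by (simp add: U_def)
qed

lemma card_unmatched_le:
  assumes E: "maximum_packing edges E" "finite E"
  shows "card (V - \<Union>E) \<le> card E"
proof -
  define U where "U = V - \<Union>E"
  have E_sub: "E \<subseteq> Pow V" and "disjoint E"
    using E(1) edges_subset_Pow by (auto simp: maximum_packing_def)
  have unmatched: "A u v = 0" if "u \<in> U" "v \<in> U" for u v
  proof (rule ccontr)
    assume "A u v \<noteq> 0"
    then have "0 < A u v" using nonneg[of u v] by simp
    then have "{u, v} \<in> edges" using that unfolding edges_def U_def by blast
    from maximum_packing_meets[OF E this] show False using that by (auto simp: U_def disjnt_def)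
  qed
  have "c * real (card U) = (\<Sum>u\<in>U. \<Sum>v\<in>V. A u v)"
    using row_sum by (simp add: U_def)
  also have "\<dots> = (\<Sum>u\<in>U. \<Sum>v\<in>\<Union>E. A u v)"
    using finite_V unmatched E_sub by (intro sum.cong refl sum.mono_neutral_right) (auto simp: U_def)
  also have "\<dots> = (\<Sum>v\<in>\<Union>E. \<Sum>u\<in>U. A u v)" by (rule sum.swap)
  also have "\<dots> = (\<Sum>e\<in>E. \<Sum>v\<in>e. \<Sum>u\<in>U. A u v)"
    using E_sub finite_V \<open>disjoint E\<close>
    by (subst sum.Union_disjoint) (auto simp: disjoint_def intro: finite_subset)
  also have "\<dots> \<le> (\<Sum>e\<in>E. c)"
    unfolding U_def by (intro sum_mono unmatched_weight_le E)
  finally have "c * real (card U) \<le> c * real (card E)" by (simp add: mult.commute)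
  then show ?thesis using c_pos by (simp add: U_def)
qed

theorem exists_disjoint_edges:
  obtains E where "E \<subseteq> edges" "disjoint E" "card V \<le> 3 * card E"
proof -
  have finite_edges: "finite edges"
    using edges_subset_Pow finite_V by (meson finite_Pow_iff finite_subset)
  then obtain E where E: "maximum_packing edges E"
    by (rule exists_maximum_packing)
  then have E_sub: "E \<subseteq> edges" and finite_E: "finite E"
    using finite_subset[OF _ finite_edges] by (auto simp: maximum_packing_def)
  have "card (\<Union>E) \<le> (\<Sum>e\<in>E. card e)" by (rule card_Union_le_sum_card)
  also have "\<dots> \<le> (\<Sum>e\<in>E. 2)"
    using E_sub by (intro sum_mono) (auto simp: edges_def card_insert_if)
  finally have "card (\<Union>E) \<le> 2 * card E" by simp
  moreover have "card V \<le> card (\<Union>E) + card (V - \<Union>E)"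
  proof -
    have "\<Union>E \<subseteq> V" using E_sub edges_subset_Pow by blast
    then show ?thesis using card_Un_le[of "\<Union>E" "V - \<Union>E"] by (simp add: Un_absorb1)
  qed
  ultimately have "card V \<le> 3 * card E"
    using card_unmatched_le[OF E finite_E] by linarith
  with E show thesis by (intro that[of E]) (auto simp: maximum_packing_def)
qed

end

section \<open>Gaps between cut points\<close>

lemma disjoint_family_on_UNION:
  assumes "disjoint_family D" "disjoint E"
  shows "disjoint_family_on (\<lambda>e. \<Union>i\<in>e. D i) E"
  unfolding disjoint_family_on_def
proof (intro ballI impI)
  fix e e' assume "e \<in> E" "e' \<in> E" "e \<noteq> e'"
  then have "e \<inter> e' = {}" using assms(2) by (simp add: disjointD)
  then have "D i \<inter> D j = {}" if "i \<in> e" "j \<in> e'" for i j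
    using disjoint_family_onD[OF assms(1), of i j] that by auto
  then show "(\<Union>i\<in>e. D i) \<inter> (\<Union>i\<in>e'. D i) = {}" by blast
qed

definition gap :: "(nat \<Rightarrow> real) \<Rightarrow> nat \<Rightarrow> real set" where
  "gap s i = {s i<..<s (Suc i)}"

lemma disjoint_family_gap:
  assumes "mono s"
  shows "disjoint_family (gap s)"
proof -
  have "gap s i \<inter> gap s j = {}" if "i < j" for i j
    using monoD[OF assms, of "Suc i" j] that by (auto simp: gap_def)
  then show ?thesis
    unfolding disjoint_family_on_def by (metis Int_commute linorder_neqE_nat)
qed

definition clearance :: "(nat \<Rightarrow> real) \<Rightarrow> real \<Rightarrow> real \<Rightarrow> nat \<Rightarrow> real" where
  "clearance s l r i = max 0 (min (l - s i) (s (Suc i) - r))"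

lemma clearance_nonneg: "0 \<le> clearance s l r i"
  by (simp add: clearance_def)

lemma interval_subset_gap: "clearance s l r i \<noteq> 0 \<Longrightarrow> {l..r} \<subseteq> gap s i"
  by (auto simp: clearance_def gap_def max_def split: if_splits)

lemma clearance_empty_gap: "s (Suc i) = s i \<Longrightarrow> l \<le> r \<Longrightarrow> clearance s l r i = 0"
  by (simp add: clearance_def)

lemma exists_clearance:
  assumes "s 0 < l" "r < s (Suc p)" "l \<le> r" and avoid: "s ` {1..p} \<inter> {l..r} = {}"
  obtains i where "i \<le> p" "clearance s l r i \<noteq> 0"
proof -
  define i where "i = (LEAST i. r < s (Suc i))"
  have right: "r < s (Suc i)" unfolding i_def using assms(2) by (rule LeastI)
  have "i \<le> p" unfolding i_def using assms(2) by (rule Least_le)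
  have "s i < l"
  proof (cases i)
    case (Suc k)
    then have "\<not> r < s i" using not_less_Least[of k "\<lambda>i. r < s (Suc i)"] by (simp add: i_def)
    moreover have "s i \<notin> {l..r}" using avoid Suc \<open>i \<le> p\<close> by force
    ultimately show ?thesis by auto
  qed (use assms(1) in simp)
  with right \<open>i \<le> p\<close> show thesis by (intro that) (auto simp: clearance_def)
qed

locale interval_pairs =
  fixes H :: "'e set" and a b a' b' :: "'e \<Rightarrow> real"
  assumes finite_H: "finite H" and ordered: "h \<in> H \<Longrightarrow> a h \<le> b h \<and> a' h \<le> b' h"
begin

definition directed_weight :: "(nat \<Rightarrow> real) \<Rightarrow> nat \<Rightarrow> nat \<Rightarrow> real" where
  "directed_weight s i j = (\<Sum>h\<in>H. clearance s (a h) (b h) i * clearance s (a' h) (b' h) j)"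

definition gap_weight :: "(nat \<Rightarrow> real) \<Rightarrow> nat \<Rightarrow> nat \<Rightarrow> real" where
  "gap_weight s i j = directed_weight s i j + directed_weight s j i"

lemma directed_weight_nonneg: "0 \<le> directed_weight s i j"
  by (simp add: directed_weight_def clearance_nonneg sum_nonneg)

lemma gap_weight_nonneg: "0 \<le> gap_weight s i j"
  by (simp add: gap_weight_def directed_weight_nonneg)

lemma gap_weight_sym: "gap_weight s i j = gap_weight s j i"
  by (simp add: gap_weight_def)

lemma gap_weight_empty_gap:
  assumes "s (Suc i) = s i"
  shows "gap_weight s i j = 0"
  using clearance_empty_gap[OF assms] ordered
  by (simp add: gap_weight_def directed_weight_def)

lemma member_of_directed_weight:
  assumes "directed_weight s i j \<noteq> 0"
  shows "\<exists>h\<in>H. {a h..b h} \<subseteq> gap s i \<and> {a' h..b' h} \<subseteq> gap s j"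
proof -
  obtain h where "h \<in> H" "clearance s (a h) (b h) i * clearance s (a' h) (b' h) j \<noteq> 0"
    using assms unfolding directed_weight_def by (rule sum.not_neutral_contains_not_neutral)
  then show ?thesis using interval_subset_gap by (metis mult_eq_0_iff)
qed

lemma member_of_gap_weight:
  assumes "0 < gap_weight s i j"
  shows "\<exists>h\<in>H. {a h..b h} \<union> {a' h..b' h} \<subseteq> gap s i \<union> gap s j"
proof -
  have "directed_weight s i j \<noteq> 0 \<or> directed_weight s j i \<noteq> 0"
    using assms by (auto simp: gap_weight_def)
  then show ?thesis using member_of_directed_weight by blast
qed

lemma cuts_meet_member_of_gap_weight_0:
  assumes h: "h \<in> H" and inside: "s 0 < min (a h) (a' h)" "max (b h) (b' h) < s (Suc p)"
    and no_weight: "\<And>i j. i \<le> p \<Longrightarrow> j \<le> p \<Longrightarrow> gap_weight s i j = 0"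
  shows "s ` {1..p} \<inter> ({a h..b h} \<union> {a' h..b' h}) \<noteq> {}"
proof
  assume avoid: "s ` {1..p} \<inter> ({a h..b h} \<union> {a' h..b' h}) = {}"
  obtain i where i: "i \<le> p" "clearance s (a h) (b h) i \<noteq> 0"
    using exists_clearance[of s "a h" "b h" p] ordered[OF h] inside avoid by auto
  obtain j where j: "j \<le> p" "clearance s (a' h) (b' h) j \<noteq> 0"
    using exists_clearance[of s "a' h" "b' h" p] ordered[OF h] inside avoid by auto
  have "0 < clearance s (a h) (b h) i * clearance s (a' h) (b' h) j"
    using i j clearance_nonneg by (simp add: order_less_le)
  also have "\<dots> \<le> directed_weight s i j"
    unfolding directed_weight_def using h finite_H by (intro member_le_sum) (auto simp: clearance_nonneg)
  also have "\<dots> \<le> gap_weight s i j" by (simp add: gap_weight_def directed_weight_nonneg)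
  finally show False using no_weight i(1) j(1) by simp
qed

lemma exists_balanced_cuts:
  obtains s c where "mono s" "\<And>h. h \<in> H \<Longrightarrow> s 0 < min (a h) (a' h) \<and> max (b h) (b' h) < s (Suc p)"
    "\<And>i. i \<le> p \<Longrightarrow> (\<Sum>j\<le>p. gap_weight s i j) = c"
proof -
  have "bounded (a ` H \<union> a' ` H \<union> b ` H \<union> b' ` H)"
    using finite_H by (intro finite_imp_bounded) auto
  then obtain B where "0 < B" and B: "\<And>x. x \<in> a ` H \<union> a' ` H \<union> b ` H \<union> b' ` H \<Longrightarrow> \<bar>x\<bar> < B"
    by (auto simp: bounded_pos_less)
  define cut where "cut x k = B * (2 * (\<Sum>i<k. x i) - 1)" for x :: "nat \<Rightarrow> real" and k
  obtain x c where x: "x \<in> standard_simplex p"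
    and c: "\<And>i. i \<le> p \<Longrightarrow> (\<Sum>j\<le>p. gap_weight (cut x) i j) = c"
  proof (rule equalize_on_standard_simplex[of p "\<lambda>x i. \<Sum>j\<le>p. gap_weight (cut x) i j"])
    show "continuous_on (standard_simplex p) (\<lambda>x. \<Sum>j\<le>p. gap_weight (cut x) i j)" for i
      unfolding gap_weight_def directed_weight_def clearance_def cut_def
      by (intro continuous_intros continuous_on_subset[OF continuous_on_product_coordinates]) auto
    show "0 \<le> (\<Sum>j\<le>p. gap_weight (cut x) i j)" for x i
      by (simp add: gap_weight_nonneg sum_nonneg)
    show "(\<Sum>j\<le>p. gap_weight (cut x) i j) = 0" if "x i = 0" for x i
      using gap_weight_empty_gap[of "cut x" i] that by (simp add: cut_def)
  qed blast
  show thesis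
  proof (rule that[OF _ _ c])
    show "mono (cut x)"
      unfolding cut_def using x \<open>0 < B\<close>
      by (intro monoI mult_left_mono diff_right_mono sum_mono2) (auto simp: standard_simplex_def)
    have "cut x 0 = - B" "cut x (Suc p) = B"
      using x by (simp_all add: cut_def standard_simplex_def lessThan_Suc_atMost)
    moreover fix h assume "h \<in> H"
    ultimately show "cut x 0 < min (a h) (a' h) \<and> max (b h) (b' h) < cut x (Suc p)"
      using B[of "a h"] B[of "a' h"] B[of "b h"] B[of "b' h"] by auto
  qed
qed

lemma exists_disjoint_gap_regions:
  assumes "mono s" and balanced: "\<And>i. i \<le> p \<Longrightarrow> (\<Sum>j\<le>p. gap_weight s i j) = c" and "c \<noteq> 0"
  obtains E where "disjoint_family_on (\<lambda>e. \<Union>i\<in>e. gap s i) E" "Suc p \<le> 3 * card E"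
    "\<And>e. e \<in> E \<Longrightarrow> \<exists>h\<in>H. {a h..b h} \<union> {a' h..b' h} \<subseteq> (\<Union>i\<in>e. gap s i)"
proof -
  have "0 \<le> c"
    using balanced[of 0] by (auto simp: gap_weight_nonneg intro!: sum_nonneg)
  then interpret gap_graph: regular_weighting "{..p}" "gap_weight s" c
    using gap_weight_sym gap_weight_nonneg balanced \<open>c \<noteq> 0\<close> by unfold_locales auto
  obtain E where E: "E \<subseteq> gap_graph.edges" "disjoint E" and large: "card {..p} \<le> 3 * card E"
    by (rule gap_graph.exists_disjoint_edges)
  show thesis
  proof (rule that)
    show "disjoint_family_on (\<lambda>e. \<Union>i\<in>e. gap s i) E"
      using disjoint_family_gap[OF \<open>mono s\<close>] E(2) by (rule disjoint_family_on_UNION)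
    show "Suc p \<le> 3 * card E" using large by simp
    fix e assume "e \<in> E"
    then obtain i j where "e = {i, j}" and "0 < gap_weight s i j"
      using E(1) by (auto simp: gap_graph.edges_def)
    then show "\<exists>h\<in>H. {a h..b h} \<union> {a' h..b' h} \<subseteq> (\<Union>i\<in>e. gap s i)"
      using member_of_gap_weight[of s i j] by simp
  qed
qed

end

section \<open>Covering 2-intervals by cut points\<close>

lemma d_interval_2D:
  assumes "d_interval 2 h"
  shows "\<exists>a b a' b'. a \<le> b \<and> a' \<le> b' \<and> {a..b} \<union> {a'..b'} = h"
proof -
  obtain k :: nat and a b :: "nat \<Rightarrow> real"
    where k: "1 \<le> k" "k \<le> 2" and ab: "\<forall>i<k. a i \<le> b i" "h = (\<Union>i<k. {a i..b i})"
    using assms unfolding d_interval_def by blast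
  have "{..<k} = {0, k - 1}" using k by auto
  then have "h = {a 0..b 0} \<union> {a (k - 1)..b (k - 1)}" using ab(2) by simp
  moreover have "a 0 \<le> b 0" "a (k - 1) \<le> b (k - 1)" using ab(1) k by auto
  ultimately show ?thesis by blast
qed

lemma card_le_matching_number_of_disjoint_regions:
  assumes "finite H" "{} \<notin> H" "disjoint_family_on T E"
    and member: "\<And>e. e \<in> E \<Longrightarrow> \<exists>h\<in>H. h \<subseteq> T e"
  shows "card E \<le> matching_number H"
proof -
  obtain f where f: "\<And>e. e \<in> E \<Longrightarrow> f e \<in> H \<and> f e \<subseteq> T e"
    using member by metis
  then have "disjoint_family_on f E"
    using assms(3) unfolding disjoint_family_on_def by blast
  moreover have "f e \<noteq> {}" if "e \<in> E" for e
    using f[OF that] assms(2) by auto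
  ultimately have "disjoint (f ` E)" "inj_on f E"
    by (simp_all add: disjoint_family_on_iff_disjoint_image)
  moreover from this(1) have "matching H (f ` E)"
    using f by (auto simp: matching_iff_disjoint)
  ultimately show ?thesis
    using card_le_matching_number[OF assms(1)] by (metis card_image)
qed

theorem frac_cover_number_2_intervals_le:
  assumes "finite H" "\<forall>h\<in>H. d_interval 2 h"
  shows "frac_cover_number H \<le> 3 * real (matching_number H)"
proof -
  obtain a b a' b' where ends: "\<And>h. h \<in> H \<Longrightarrow> a h \<le> b h \<and> a' h \<le> b' h \<and> {a h..b h} \<union> {a' h..b' h} = h"
    using assms(2) d_interval_2D by metis
  interpret interval_pairs H a b a' b'
    using assms(1) ends by unfold_locales auto
  define p where "p = 3 * matching_number H"
  obtain s c where "mono s"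
    and inside: "\<And>h. h \<in> H \<Longrightarrow> s 0 < min (a h) (a' h) \<and> max (b h) (b' h) < s (Suc p)"
    and balanced: "\<And>i. i \<le> p \<Longrightarrow> (\<Sum>j\<le>p. gap_weight s i j) = c"
    using exists_balanced_cuts by metis
  have "c = 0"
  proof (rule ccontr)
    assume "c \<noteq> 0"
    then obtain E where disjoint: "disjoint_family_on (\<lambda>e. \<Union>i\<in>e. gap s i) E" and "Suc p \<le> 3 * card E"
      and member: "\<And>e. e \<in> E \<Longrightarrow> \<exists>h\<in>H. {a h..b h} \<union> {a' h..b' h} \<subseteq> (\<Union>i\<in>e. gap s i)"
      using exists_disjoint_gap_regions[OF \<open>mono s\<close> balanced] by blast
    have "card E \<le> matching_number H"
    proof (rule card_le_matching_number_of_disjoint_regions[OF assms(1) _ disjoint])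
      show "{} \<notin> H" using assms(2) d_interval_nonempty by blast
      show "\<exists>h\<in>H. h \<subseteq> (\<Union>i\<in>e. gap s i)" if "e \<in> E" for e
        using member[OF that] ends by metis
    qed
    then show False using \<open>Suc p \<le> 3 * card E\<close> by (simp add: p_def)
  qed
  then have "gap_weight s i j = 0" if "i \<le> p" "j \<le> p" for i j
    using balanced[OF that(1)] that(2) gap_weight_nonneg by (simp add: sum_nonneg_eq_0_iff)
  then have "s ` {1..p} \<inter> h \<noteq> {}" if "h \<in> H" for h
    using cuts_meet_member_of_gap_weight_0[of h s p] inside ends that by metis
  then have "frac_cover_number H \<le> real (card (s ` {1..p}))"
    by (intro frac_cover_number_le_card) auto
  also have "\<dots> \<le> real p"
    using card_image_le[of "{1..p}" s] by simp
  finally show ?thesis by (simp add: p_def)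
qed

theorem theorem7p1:
  fixes d :: nat and H :: "real set set"
  assumes "d \<ge> 1" and "finite H" and "\<forall>h\<in>H. d_interval d h"
  shows "frac_cover_number H \<le> (4 * real d - 6 + 3 / real d) * real (matching_number H)"
proof -
  obtain k where "frac_cover_number H \<le> k * real (matching_number H)" "k \<le> 4 * real d - 6 + 3 / real d"
  proof -
    consider "d = 1" | "d = 2" | "3 \<le> d" using assms(1) by linarith
    then show thesis
    proof cases
      case 1
      then show thesis using frac_cover_number_intervals_le assms(2,3) by (intro that[of 1]) auto
    next
      case 2
      then show thesis using frac_cover_number_2_intervals_le assms(2,3) by (intro that[of 3]) auto
    next
      case 3
      then have "0 \<le> 3 / real d" "3 \<le> real d" by auto
      then have "2 * real d \<le> 4 * real d - 6 + 3 / real d" by linarith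
      then show thesis using frac_cover_number_d_intervals_le assms(2,3) by (intro that) auto
    qed
  qed
  then show ?thesis
    by (meson mult_right_mono of_nat_0_le_iff order_trans)
qed

end
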